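(* For any Tychonoff space $X$ and any ideal $I$ in $C(X)$, $$w(C_{m^I}(X))=d(C_{m^I}(X))=c(C_{m^I}(X))=L(C_{m^I}(X)).$$
   Context: $C(X)$ is the ring of all real-valued continuous functions on $X$; ideals may be improper. $C_+(X)$ is the set of strictly positive $u\in C(X)$. The $m^I$-topology on $C(X)$ has as base the sets $B_m(f,I,u)=\{g\in C(X):|f(x)-g(x)|<u(x)\ \forall x\in X,\ f-g\in I\}$, $f\in C(X)$, $u\in C_+(X)$; $C_{m^I}(X)$ is $C(X)$ with this topology. For a space $Y$: the weight is $w(Y)=\aleph_0+\min\{|\mathcal B|:\mathcal B\text{ is a base for }Y\}$; the density is $d(Y)=\aleph_0+\min\{|D|:D\text{ is dense in }Y\}$; the cellularity is $c(Y)=\aleph_0+\sup\{|\mathcal U|:\mathcal U\text{ is a family of pairwise disjoint nonempty open subsets of }Y\}$; the Lindelöf number is $L(Y)=\aleph_0+\min\{\mathfrak m:\text{every open cover of }Y\text{ has a subcover of cardinality}\le\mathfrak m\}$. *)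

theory Defs
  imports "HOL-Analysis.Analysis" "HOL-Algebra.Ideal"
begin

unbundle cardinal_syntax

text \<open>
  Tychonoff means completely regular and Hausdorff. Spaces are abstract topologies, so the empty
  space is included.
\<close>

definition tychonoff_space :: "'a topology \<Rightarrow> bool" where
  "tychonoff_space X \<longleftrightarrow> completely_regular_space X \<and> Hausdorff_space X"

text \<open>
  Continuous functions are taken extensional (undefined outside \<open>topspace X\<close>), so that each
  continuous function on the space is represented by exactly one HOL function.
\<close>

definition Cont :: "'a topology \<Rightarrow> ('a \<Rightarrow> real) set" where
  "Cont X = {f \<in> extensional (topspace X). continuous_map X euclideanreal f}"

definition Cont_pos :: "'a topology \<Rightarrow> ('a \<Rightarrow> real) set" where
  "Cont_pos X = {u \<in> Cont X. \<forall>x\<in>topspace X. 0 < u x}"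

definition Cont_ring :: "'a topology \<Rightarrow> ('a \<Rightarrow> real) ring" where
  "Cont_ring X =
     \<lparr>carrier = Cont X,
      monoid.mult = (\<lambda>f g. \<lambda>x\<in>topspace X. f x * g x),
      one = (\<lambda>x\<in>topspace X. 1),
      zero = (\<lambda>x\<in>topspace X. 0),
      add = (\<lambda>f g. \<lambda>x\<in>topspace X. f x + g x)\<rparr>"

definition mI_ball :: "'a topology \<Rightarrow> ('a \<Rightarrow> real) set \<Rightarrow> ('a \<Rightarrow> real) \<Rightarrow> ('a \<Rightarrow> real) \<Rightarrow> ('a \<Rightarrow> real) set" where
  "mI_ball X I f u =
     {g \<in> Cont X. (\<forall>x\<in>topspace X. \<bar>f x - g x\<bar> < u x) \<and> (\<lambda>x\<in>topspace X. f x - g x) \<in> I}"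

definition mI_base :: "'a topology \<Rightarrow> ('a \<Rightarrow> real) set \<Rightarrow> ('a \<Rightarrow> real) set set" where
  "mI_base X I = {mI_ball X I f u | f u. f \<in> Cont X \<and> u \<in> Cont_pos X}"

definition mI_topology :: "'a topology \<Rightarrow> ('a \<Rightarrow> real) set \<Rightarrow> ('a \<Rightarrow> real) topology" where
  "mI_topology X I = topology (arbitrary union_of (\<lambda>U. U \<in> mI_base X I))"

text \<open>
  Cardinals are cardinal orders, compared across types by \<open>\<le>o\<close> and \<open>=o\<close>. The minimum of a set of
  cardinals is determined only up to \<open>=o\<close>, so \<open>min_card\<close> picks one representative. The
  cardinals needed for a space with points of type \<open>'b\<close> are all represented on the types \<open>'b\<close> and
  \<open>'b set\<close>; the lemmas below show that the minima exist.
\<close>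

definition min_card :: "'k rel set \<Rightarrow> 'k rel" where
  "min_card R = (SOME r. r \<in> R \<and> (\<forall>s\<in>R. r \<le>o s))"

definition sup_card :: "'k rel set \<Rightarrow> 'k rel" where
  "sup_card R = min_card {s. Card_order s \<and> (\<forall>r\<in>R. r \<le>o s)}"

definition base_of :: "'b topology \<Rightarrow> 'b set set \<Rightarrow> bool" where
  "base_of Y \<B> \<longleftrightarrow> openin Y = arbitrary union_of (\<lambda>U. U \<in> \<B>)"

definition dense_in :: "'b topology \<Rightarrow> 'b set \<Rightarrow> bool" where
  "dense_in Y D \<longleftrightarrow> D \<subseteq> topspace Y \<and> Y closure_of D = topspace Y"

definition cellular_family :: "'b topology \<Rightarrow> 'b set set \<Rightarrow> bool" where
  "cellular_family Y \<U> \<longleftrightarrow> (\<forall>U\<in>\<U>. openin Y U \<and> U \<noteq> {}) \<and> pairwise disjnt \<U>"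

definition open_cover :: "'b topology \<Rightarrow> 'b set set \<Rightarrow> bool" where
  "open_cover Y \<U> \<longleftrightarrow> (\<forall>U\<in>\<U>. openin Y U) \<and> \<Union>\<U> = topspace Y"

definition lindelof_bound :: "'b topology \<Rightarrow> 'b set rel \<Rightarrow> bool" where
  "lindelof_bound Y m \<longleftrightarrow> (\<forall>\<U>. open_cover Y \<U> \<longrightarrow> (\<exists>\<V>\<subseteq>\<U>. open_cover Y \<V> \<and> |\<V>| \<le>o m))"

definition weight :: "'b topology \<Rightarrow> (nat + 'b set) rel" where
  "weight Y = natLeq +c min_card {|\<B>| | \<B>. base_of Y \<B>}"

definition density_number :: "'b topology \<Rightarrow> (nat + 'b) rel" where
  "density_number Y = natLeq +c min_card {|D| | D. dense_in Y D}"

definition cellularity :: "'b topology \<Rightarrow> (nat + 'b set) rel" where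
  "cellularity Y = natLeq +c sup_card {|\<U>| | \<U>. cellular_family Y \<U>}"

definition lindelof_number :: "'b topology \<Rightarrow> (nat + 'b set) rel" where
  "lindelof_number Y = natLeq +c min_card {m. Card_order m \<and> lindelof_bound Y m}"

subsection \<open>Well-definedness\<close>

lemma min_card_least:
  assumes "R \<noteq> {}" "\<And>r. r \<in> R \<Longrightarrow> Card_order r"
  shows "min_card R \<in> R \<and> (\<forall>s\<in>R. min_card R \<le>o s)"
proof -
  have "\<exists>r. r \<in> R \<and> (\<forall>s\<in>R. r \<le>o s)"
    using exists_minim_Card_order[of R] assms by auto
  then show ?thesis
    unfolding min_card_def by (rule someI_ex)
qed

lemma sup_card_least_upper_bound:
  fixes R :: "'k rel set"
  assumes "\<And>r. r \<in> R \<Longrightarrow> Card_order r"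
  shows "Card_order (sup_card R)"
    and "r \<in> R \<Longrightarrow> r \<le>o sup_card R"
    and "\<lbrakk>Card_order (s :: 'k rel); \<And>r. r \<in> R \<Longrightarrow> r \<le>o s\<rbrakk> \<Longrightarrow> sup_card R \<le>o s"
proof -
  let ?B = "{s :: 'k rel. Card_order s \<and> (\<forall>r\<in>R. r \<le>o s)}"
  have "r \<le>o |UNIV :: 'k set|" if "r \<in> R" for r
    by (rule ordIso_ordLeq_trans[OF ordIso_symmetric[OF card_of_Field_ordIso[OF assms[OF that]]]])
      (simp add: card_of_mono1)
  then have "|UNIV :: 'k set| \<in> ?B"
    by (simp add: card_of_Card_order)
  then have "?B \<noteq> {}"
    by blast
  then have "sup_card R \<in> ?B \<and> (\<forall>s\<in>?B. sup_card R \<le>o s)"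
    unfolding sup_card_def by (rule min_card_least) simp
  then have *: "Card_order (sup_card R)" "\<forall>r\<in>R. r \<le>o sup_card R"
    "\<forall>s :: 'k rel. Card_order s \<and> (\<forall>r\<in>R. r \<le>o s) \<longrightarrow> sup_card R \<le>o s"
    by simp_all
  show "Card_order (sup_card R)"
    by (rule *(1))
  show "r \<in> R \<Longrightarrow> r \<le>o sup_card R"
    by (rule *(2)[rule_format])
  show "\<lbrakk>Card_order (s :: 'k rel); \<And>r. r \<in> R \<Longrightarrow> r \<le>o s\<rbrakk> \<Longrightarrow> sup_card R \<le>o s"
    by (rule *(3)[rule_format]) blast
qed

lemma weight_minimum_exists: "{|\<B>| | \<B>. base_of Y \<B>} \<noteq> {}"
proof -
  have "base_of Y {U. openin Y U}"
    unfolding base_of_def openin_topology_base_unique by auto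
  then show ?thesis by blast
qed

lemma density_minimum_exists: "{|D| | D. dense_in Y D} \<noteq> {}"
proof -
  have "dense_in Y (topspace Y)"
    unfolding dense_in_def by simp
  then show ?thesis by blast
qed

lemma lindelof_minimum_exists: "{m. Card_order m \<and> lindelof_bound Y m} \<noteq> {}"
proof -
  have "lindelof_bound Y |UNIV|"
    unfolding lindelof_bound_def by (blast intro: card_of_mono1)
  then show ?thesis using card_of_Card_order by blast
qed

lemma Cont_arith:
  assumes "f \<in> Cont X" "g \<in> Cont X"
  shows "(\<lambda>x\<in>topspace X. f x + g x) \<in> Cont X"
    and "(\<lambda>x\<in>topspace X. f x - g x) \<in> Cont X"
    and "(\<lambda>x\<in>topspace X. f x * g x) \<in> Cont X"
    and "(\<lambda>x\<in>topspace X. \<bar>f x\<bar>) \<in> Cont X"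
    and "(\<lambda>x\<in>topspace X. min (f x) (g x)) \<in> Cont X"
  using assms unfolding Cont_def
  by (auto intro!: continuous_map_add continuous_map_diff continuous_map_real_mult
        continuous_map_real_abs continuous_map_real_min)

lemma Cont_const: "(\<lambda>x\<in>topspace X. c) \<in> Cont X"
  unfolding Cont_def by auto

lemma Cont_restrict: "f \<in> Cont X \<Longrightarrow> restrict f (topspace X) = f"
  unfolding Cont_def by (auto simp: extensional_restrict)

lemma Cont_ring_cring: "cring (Cont_ring X)"
proof (rule cringI)
  show "abelian_group (Cont_ring X)"
  proof (rule abelian_groupI)
    fix f assume f: "f \<in> carrier (Cont_ring X)"
    have "(\<lambda>x\<in>topspace X. (\<lambda>x\<in>topspace X. 0) x - f x) \<in> Cont X"
      using f by (intro Cont_arith Cont_const) (auto simp: Cont_ring_def)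
    then show "\<exists>g\<in>carrier (Cont_ring X). g \<oplus>\<^bsub>Cont_ring X\<^esub> f = \<zero>\<^bsub>Cont_ring X\<^esub>"
      by (intro bexI[where x = "\<lambda>x\<in>topspace X. (\<lambda>x\<in>topspace X. 0) x - f x"])
        (auto simp: Cont_ring_def)
  qed (auto simp: Cont_ring_def Cont_arith Cont_const Cont_restrict algebra_simps
        cong: restrict_cong)
  show "Group.comm_monoid (Cont_ring X)"
    by (rule comm_monoidI)
      (auto simp: Cont_ring_def Cont_arith Cont_const Cont_restrict algebra_simps
        cong: restrict_cong)
qed (auto simp: Cont_ring_def algebra_simps)

lemma ideal_diff:
  assumes I: "ideal I (Cont_ring X)" and f: "f \<in> I" and g: "g \<in> I"
  shows "(\<lambda>x\<in>topspace X. f x - g x) \<in> I"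
proof -
  interpret ideal I "Cont_ring X" by (rule I)
  have fg: "f \<in> Cont X" "g \<in> Cont X"
    using f g a_subset by (auto simp: Cont_ring_def)
  define h where "h = (\<lambda>x\<in>topspace X. (\<lambda>x\<in>topspace X. 0) x - g x)"
  have h: "h \<in> Cont X"
    unfolding h_def by (intro Cont_arith Cont_const fg)
  have "\<ominus>\<^bsub>Cont_ring X\<^esub> g = h"
    by (rule minus_equality) (use h fg in \<open>auto simp: Cont_ring_def h_def\<close>)
  moreover have "\<ominus>\<^bsub>Cont_ring X\<^esub> g \<in> I"
    using g by (rule additive_subgroup.a_inv_closed[OF additive_subgroup_axioms])
  ultimately have "f \<oplus>\<^bsub>Cont_ring X\<^esub> h \<in> I"
    using f by (simp add: additive_subgroup.a_closed[OF additive_subgroup_axioms])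
  moreover have "f \<oplus>\<^bsub>Cont_ring X\<^esub> h = (\<lambda>x\<in>topspace X. f x - g x)"
    by (auto simp: Cont_ring_def h_def)
  ultimately show ?thesis by simp
qed

lemma mI_base_refine:
  assumes I: "ideal I (Cont_ring X)" and "U \<in> mI_base X I" "V \<in> mI_base X I" "g \<in> U \<inter> V"
  shows "\<exists>W\<in>mI_base X I. g \<in> W \<and> W \<subseteq> U \<inter> V"
proof -
  obtain f u where U: "U = mI_ball X I f u" and f: "f \<in> Cont X" and u: "u \<in> Cont_pos X"
    using assms unfolding mI_base_def by auto
  obtain f' u' where V: "V = mI_ball X I f' u'" and f': "f' \<in> Cont X" and u': "u' \<in> Cont_pos X"
    using assms unfolding mI_base_def by auto
  have g: "g \<in> Cont X" using assms U by (auto simp: mI_ball_def)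
  let ?T = "topspace X"
  define r where "r = (\<lambda>f u. \<lambda>x\<in>?T. u x - (\<lambda>x\<in>?T. \<bar>(\<lambda>x\<in>?T. f x - g x) x\<bar>) x)"
  define v where "v = (\<lambda>x\<in>?T. min (r f u x) (r f' u' x))"
  have "v \<in> Cont X"
    unfolding v_def r_def using f f' g u u' by (intro Cont_arith) (auto simp: Cont_pos_def)
  then have v: "v \<in> Cont_pos X"
    using assms(4) unfolding U V by (auto simp: mI_ball_def Cont_pos_def v_def r_def)
  have sub: "mI_ball X I g v \<subseteq> mI_ball X I e w"
    if "g \<in> mI_ball X I e w" and le: "\<And>x. x \<in> ?T \<Longrightarrow> v x \<le> w x - \<bar>e x - g x\<bar>" for e w
  proof
    fix h assume h: "h \<in> mI_ball X I g v"
    interpret ideal I "Cont_ring X" by (rule I)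
    let ?a = "\<lambda>x\<in>?T. e x - g x" and ?b = "\<lambda>x\<in>?T. g x - h x"
    have "?a \<oplus>\<^bsub>Cont_ring X\<^esub> ?b \<in> I"
      using that(1) h by (intro additive_subgroup.a_closed[OF additive_subgroup_axioms]) (auto simp: mI_ball_def)
    moreover have "?a \<oplus>\<^bsub>Cont_ring X\<^esub> ?b = (\<lambda>x\<in>?T. e x - h x)"
      by (auto simp: Cont_ring_def)
    moreover have "\<bar>e x - h x\<bar> < w x" if x: "x \<in> ?T" for x
    proof -
      have "\<bar>g x - h x\<bar> < v x"
        using h x by (auto simp: mI_ball_def)
      then show ?thesis using le[OF x] by linarith
    qed
    ultimately show "h \<in> mI_ball X I e w"
      using h by (auto simp: mI_ball_def)
  qed
  have "mI_ball X I g v \<subseteq> U \<inter> V"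
    unfolding U V using assms(4) unfolding U V
    by (intro Int_greatest sub) (auto simp: v_def r_def)
  moreover have "g \<in> mI_ball X I g v"
    using ideal_diff[OF I, of "\<lambda>x\<in>?T. f x - g x" "\<lambda>x\<in>?T. f x - g x"] assms(4) v g
    by (auto simp: U mI_ball_def Cont_pos_def cong: restrict_cong)
  moreover have "mI_ball X I g v \<in> mI_base X I"
    using g v by (auto simp: mI_base_def)
  ultimately show ?thesis by blast
qed

lemma openin_mI_topology:
  assumes "ideal I (Cont_ring X)"
  shows "openin (mI_topology X I) = arbitrary union_of (\<lambda>U. U \<in> mI_base X I)"
proof -
  have "istopology (arbitrary union_of (\<lambda>U. U \<in> mI_base X I))"
    unfolding istopology_base_eq
  proof (intro allI impI, elim conjE)
    fix U V assume "U \<in> mI_base X I" "V \<in> mI_base X I"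
    then have "U \<inter> V = \<Union>{W \<in> mI_base X I. W \<subseteq> U \<inter> V}"
      using mI_base_refine[OF assms] by blast
    then show "(arbitrary union_of (\<lambda>U. U \<in> mI_base X I)) (U \<inter> V)"
      unfolding union_of_def arbitrary_def by (intro exI conjI) auto
  qed
  then show ?thesis
    unfolding mI_topology_def by (simp add: topology_inverse')
qed

lemma topspace_mI_topology:
  assumes "ideal I (Cont_ring X)"
  shows "topspace (mI_topology X I) = Cont X"
proof
  show "topspace (mI_topology X I) \<subseteq> Cont X"
    unfolding topspace_def openin_mI_topology[OF assms] union_of_def mI_base_def mI_ball_def
    by blast
  show "Cont X \<subseteq> topspace (mI_topology X I)"
  proof
    fix f assume f: "f \<in> Cont X"
    interpret ideal I "Cont_ring X" by (rule assms)
    let ?u = "\<lambda>x\<in>topspace X. 1"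
    have "?u \<in> Cont_pos X"
      by (auto simp: Cont_pos_def Cont_const)
    then have "mI_ball X I f ?u \<in> mI_base X I"
      using f by (auto simp: mI_base_def)
    then have "openin (mI_topology X I) (mI_ball X I f ?u)"
      unfolding openin_mI_topology[OF assms] by (intro arbitrary_union_of_inc)
    moreover have "(\<lambda>x\<in>topspace X. 0) \<in> I"
      using additive_subgroup.zero_closed[OF additive_subgroup_axioms] by (simp add: Cont_ring_def)
    then have "f \<in> mI_ball X I f ?u"
      using f by (auto simp: mI_ball_def)
    ultimately show "f \<in> topspace (mI_topology X I)"
      using openin_subset by blast
  qed
qed

end

theory Submission
  imports Defs
begin

text \<open>
  Call \<open>D\<close> a net of radius \<open>u\<close> if the balls of radius \<open>u\<close> around its points cover \<open>C(X)\<close>. Density,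
  cellularity and the Lindelof number each bound the size of suitable nets of any radius. A net \<open>D\<close>
  of radius \<open>1\<close> already controls the radii: for \<open>u > 0\<close> some \<open>f \<in> D\<close> satisfies \<open>f + 1 > 1/u\<close>, so the
  functions \<open>1/(f + 1)\<close> with \<open>f + 1 > 0\<close> are coinitial among the positive functions. Nets for
  these few radii together yield a base.
\<close>

section \<open>Cardinal functions of arbitrary spaces\<close>

lemma base_ofD:
  assumes "base_of Y \<B>"
  shows "B \<in> \<B> \<Longrightarrow> openin Y B"
    and "openin Y U \<Longrightarrow> x \<in> U \<Longrightarrow> \<exists>B\<in>\<B>. x \<in> B \<and> B \<subseteq> U"
proof -
  show "openin Y B" if "B \<in> \<B>"
    using that assms unfolding base_of_def by (simp add: arbitrary_union_of_inc)
  show "\<exists>B\<in>\<B>. x \<in> B \<and> B \<subseteq> U" if "openin Y U" "x \<in> U"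
    using that assms openin_topology_base_unique[of Y "\<lambda>B. B \<in> \<B>"] unfolding base_of_def by blast
qed

lemma dense_inD:
  assumes "dense_in Y D" "openin Y U" "U \<noteq> {}"
  shows "\<exists>x\<in>D. x \<in> U"
proof -
  obtain y where "y \<in> U" using assms(3) by blast
  then have "y \<in> Y closure_of D"
    using assms openin_subset unfolding dense_in_def by blast
  then show ?thesis
    using \<open>y \<in> U\<close> assms(2) by (auto simp: in_closure_of)
qed

text \<open>One point chosen from each nonempty basic set gives \<open>D\<close>: every
  neighbourhood of a point contains a basic set around it, hence that set's chosen point.\<close>

lemma density_base_le:
  assumes "base_of Y \<B>"
  shows "\<exists>D. dense_in Y D \<and> |D| \<le>o |\<B>|"
proof (intro exI conjI)
  define D where "D = (\<lambda>B. SOME x. x \<in> B) ` (\<B> - {{}})"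
  have some: "(SOME x. x \<in> B) \<in> B" if "B \<in> \<B> - {{}}" for B
    using that by (simp add: some_in_eq)
  have sub: "D \<subseteq> topspace Y"
    using some base_ofD(1)[OF assms] openin_subset unfolding D_def by blast
  have "x \<in> Y closure_of D" if "x \<in> topspace Y" for x
    unfolding in_closure_of
  proof (intro conjI that allI impI)
    fix T assume "x \<in> T \<and> openin Y T"
    then obtain B where "B \<in> \<B>" "x \<in> B" "B \<subseteq> T"
      using base_ofD(2)[OF assms] by blast
    then show "\<exists>y. y \<in> D \<and> y \<in> T"
      using some[of B] unfolding D_def by blast
  qed
  then show "dense_in Y D"
    using sub closure_of_subset_topspace[of Y D] unfolding dense_in_def by blast
  have "|D| \<le>o |\<B> - {{}}|"
    unfolding D_def by (rule card_of_image)
  also have "|\<B> - {{}}| \<le>o |\<B>|"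
    by (rule card_of_mono1) blast
  finally show "|D| \<le>o |\<B>|" .
qed

text \<open>Each member contains a nonempty basic set; two disjoint members cannot contain the same
  one, so this choice is injective.\<close>

lemma cellular_family_base_le:
  assumes "base_of Y \<B>" "cellular_family Y \<U>"
  shows "|\<U>| \<le>o |\<B>|"
proof -
  have "\<forall>U\<in>\<U>. \<exists>B. B \<in> \<B> \<and> B \<noteq> {} \<and> B \<subseteq> U"
  proof
    fix U assume "U \<in> \<U>"
    then obtain x where "openin Y U" "x \<in> U"
      using assms(2) unfolding cellular_family_def by blast
    then obtain B where "B \<in> \<B>" "x \<in> B" "B \<subseteq> U"
      using base_ofD(2)[OF assms(1)] by metis
    then show "\<exists>B. B \<in> \<B> \<and> B \<noteq> {} \<and> B \<subseteq> U"
      by blast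
  qed
  then obtain b where b: "\<And>U. U \<in> \<U> \<Longrightarrow> b U \<in> \<B> \<and> b U \<noteq> {} \<and> b U \<subseteq> U"
    by metis
  have "inj_on b \<U>"
  proof (rule inj_onI, rule ccontr)
    fix U V assume UV: "U \<in> \<U>" "V \<in> \<U>" "b U = b V" "U \<noteq> V"
    then have "disjnt U V"
      using assms(2) unfolding cellular_family_def pairwise_def by blast
    then show False
      using b[OF UV(1)] b[OF UV(2)] UV(3) unfolding disjnt_def by blast
  qed
  moreover have "b ` \<U> \<subseteq> \<B>" using b by blast
  ultimately show ?thesis
    using card_of_ordLeq by blast
qed

lemma lindelof_bound_base:
  assumes "base_of Y \<B>"
  shows "lindelof_bound Y |\<B>|"
  unfolding lindelof_bound_def
proof (intro allI impI)
  fix \<U> assume \<U>: "open_cover Y \<U>"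
  \<comment> \<open>These are the basic sets that fit inside a member of the cover. They still cover
    the space, so one enclosing member for each of them suffices.\<close>
  define \<A> where "\<A> = {B \<in> \<B>. \<exists>U\<in>\<U>. B \<subseteq> U}"
  have "\<forall>B\<in>\<A>. \<exists>U. U \<in> \<U> \<and> B \<subseteq> U"
    unfolding \<A>_def by blast
  then obtain c where c: "\<And>B. B \<in> \<A> \<Longrightarrow> c B \<in> \<U> \<and> B \<subseteq> c B"
    by metis
  have "\<Union>\<U> \<subseteq> \<Union>(c ` \<A>)"
  proof
    fix x assume "x \<in> \<Union>\<U>"
    then obtain U where U: "U \<in> \<U>" "x \<in> U" by blast
    then obtain B where "B \<in> \<B>" "x \<in> B" "B \<subseteq> U"
      using \<U> base_ofD(2)[OF assms] unfolding open_cover_def by metis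
    then show "x \<in> \<Union>(c ` \<A>)"
      using c[of B] U unfolding \<A>_def by blast
  qed
  then have "open_cover Y (c ` \<A>)"
    using \<U> c unfolding open_cover_def by blast
  moreover have "|c ` \<A>| \<le>o |\<B>|"
    by (rule ordLeq_transitive[OF card_of_image card_of_mono1]) (auto simp: \<A>_def)
  ultimately show "\<exists>\<V>\<subseteq>\<U>. open_cover Y \<V> \<and> |\<V>| \<le>o |\<B>|"
    using c by (intro exI[of _ "c ` \<A>"]) blast
qed

text \<open>The representative picked by \<open>min_card\<close> lies in the family itself, so it is
  literally \<open>|A|\<close> for some witness \<open>A\<close>, and later proofs can rewrite with
  this equality.\<close>

lemma min_card_card_of:
  assumes "{|A| | A. P A} \<noteq> {}"
  shows "\<exists>A. P A \<and> min_card {|A| | A. P A} = |A|"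
    and "P B \<Longrightarrow> min_card {|A| | A. P A} \<le>o |B|"
proof -
  have "min_card {|A| | A. P A} \<in> {|A| | A. P A} \<and> (\<forall>s\<in>{|A| | A. P A}. min_card {|A| | A. P A} \<le>o s)"
    using assms by (rule min_card_least) (auto simp: card_of_Card_order)
  then show "\<exists>A. P A \<and> min_card {|A| | A. P A} = |A|" "P B \<Longrightarrow> min_card {|A| | A. P A} \<le>o |B|"
    by blast+
qed

lemma min_card_base_of:
  obtains \<B> where "base_of Y \<B>" "min_card {|\<B>| | \<B>. base_of Y \<B>} = |\<B>|"
  using min_card_card_of(1)[OF weight_minimum_exists, of Y] by blast

lemma min_card_lindelof:
  fixes Y :: "'b topology" and m :: "'b set rel"
  shows "Card_order (min_card {m. Card_order m \<and> lindelof_bound Y m})"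
    and "lindelof_bound Y (min_card {m. Card_order m \<and> lindelof_bound Y m})"
    and "Card_order m \<Longrightarrow> lindelof_bound Y m \<Longrightarrow>
           min_card {m. Card_order m \<and> lindelof_bound Y m} \<le>o m"
  using min_card_least[OF lindelof_minimum_exists, of Y] by blast+

text \<open>A supremum need not be attained by a single cellular family, so it is handled through
  its two defining properties rather than through a witness as for \<open>min_card\<close>.\<close>

lemma sup_card_cellular:
  fixes Y :: "'b topology" and s :: "'b set rel"
  shows "Card_order (sup_card {|\<U>| | \<U>. cellular_family Y \<U>})"
    and "cellular_family Y \<U> \<Longrightarrow> |\<U>| \<le>o sup_card {|\<U>| | \<U>. cellular_family Y \<U>}"
    and "Card_order s \<Longrightarrow> (\<And>\<U>. cellular_family Y \<U> \<Longrightarrow> |\<U>| \<le>o s) \<Longrightarrow>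
           sup_card {|\<U>| | \<U>. cellular_family Y \<U>} \<le>o s"
proof -
  let ?R = "{|\<U>| | \<U>. cellular_family Y \<U>}"
  have R: "\<And>r. r \<in> ?R \<Longrightarrow> Card_order r" by (auto simp: card_of_Card_order)
  show "Card_order (sup_card ?R)"
    using sup_card_least_upper_bound(1)[OF R] .
  show "cellular_family Y \<U> \<Longrightarrow> |\<U>| \<le>o sup_card ?R"
    by (rule sup_card_least_upper_bound(2)[OF R]) auto
  show "sup_card ?R \<le>o s" if "Card_order s" "\<And>\<U>. cellular_family Y \<U> \<Longrightarrow> |\<U>| \<le>o s"
    by (rule sup_card_least_upper_bound(3)[OF R that(1)]) (auto intro: that(2))
qed

section \<open>Density, cellularity and Lindelof number against the weight\<close>

lemma Cinfinite_natLeq_csum: "Cinfinite (natLeq +c r)"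
  by (rule Cinfinite_csum1[OF natLeq_Cinfinite])

lemma density_number_le_weight: "density_number Y \<le>o weight Y"
proof -
  obtain \<B> where \<B>: "base_of Y \<B>" "min_card {|\<B>| | \<B>. base_of Y \<B>} = |\<B>|"
    by (rule min_card_base_of)
  obtain D where "dense_in Y D" "|D| \<le>o |\<B>|"
    using density_base_le[OF \<B>(1)] by blast
  then show ?thesis
    unfolding density_number_def weight_def \<B>(2)
    by (blast intro: csum_mono2 ordLeq_transitive min_card_card_of(2)[OF density_minimum_exists])
qed

lemma cellularity_le_weight: "cellularity Y \<le>o weight Y"
proof -
  obtain \<B> where \<B>: "base_of Y \<B>" "min_card {|\<B>| | \<B>. base_of Y \<B>} = |\<B>|"
    by (rule min_card_base_of)
  show ?thesis
    unfolding cellularity_def weight_def \<B>(2)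
    by (intro csum_mono2 sup_card_cellular(3) card_of_Card_order cellular_family_base_le[OF \<B>(1)])
qed

lemma lindelof_number_le_weight: "lindelof_number Y \<le>o weight Y"
proof -
  obtain \<B> where \<B>: "base_of Y \<B>" "min_card {|\<B>| | \<B>. base_of Y \<B>} = |\<B>|"
    by (rule min_card_base_of)
  show ?thesis
    unfolding lindelof_number_def weight_def \<B>(2)
    by (intro csum_mono2 min_card_lindelof(3) card_of_Card_order lindelof_bound_base[OF \<B>(1)])
qed

text \<open>An infinite cardinal absorbs the summand \<open>natLeq\<close>, so bounding a single
  base is enough.\<close>

lemma weight_le:
  assumes "base_of Y \<B>" "|\<B>| \<le>o \<kappa>" "Cinfinite \<kappa>"
  shows "weight Y \<le>o \<kappa>"
proof -
  let ?m = "min_card {|\<B>| | \<B>. base_of Y \<B>}"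
  have "Card_order ?m"
    using min_card_card_of(1)[OF weight_minimum_exists, of Y] card_of_Card_order by metis
  moreover have "?m \<le>o \<kappa>"
    using min_card_card_of(2)[OF weight_minimum_exists assms(1)] assms(2) by (rule ordLeq_transitive)
  ultimately show ?thesis
    unfolding weight_def
    by (intro csum_cinfinite_bound natLeq_ordLeq_cinfinite natLeq_Card_order assms(3))
qed

section \<open>Balls and nets\<close>

lemma mI_ball_centre:
  assumes "ideal I (Cont_ring X)" "f \<in> Cont X" "u \<in> Cont_pos X"
  shows "f \<in> mI_ball X I f u"
proof -
  interpret ideal I "Cont_ring X" by (rule assms)
  have "(\<lambda>x\<in>topspace X. 0) \<in> I"
    using additive_subgroup.zero_closed[OF additive_subgroup_axioms] by (simp add: Cont_ring_def)
  then show ?thesis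
    using assms by (auto simp: mI_ball_def Cont_pos_def)
qed

lemma mI_ball_sym:
  assumes "ideal I (Cont_ring X)" "f \<in> Cont X" "g \<in> mI_ball X I f u"
  shows "f \<in> mI_ball X I g u"
proof -
  interpret ideal I "Cont_ring X" by (rule assms)
  let ?T = "topspace X"
  have z: "(\<lambda>x\<in>?T. 0) \<in> I"
    using additive_subgroup.zero_closed[OF additive_subgroup_axioms] by (simp add: Cont_ring_def)
  have fg: "(\<lambda>x\<in>?T. f x - g x) \<in> I"
    using assms(3) unfolding mI_ball_def by blast
  \<comment> \<open>Negation in \<open>I\<close> is obtained as subtraction from zero, written in
    the shape that \<open>ideal_diff\<close> produces.\<close>
  have "(\<lambda>x\<in>?T. (\<lambda>x\<in>?T. 0) x - (\<lambda>x\<in>?T. f x - g x) x) \<in> I"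
    by (rule ideal_diff[OF assms(1) z fg])
  then have "(\<lambda>x\<in>?T. g x - f x) \<in> I"
    by (simp cong: restrict_cong)
  then show ?thesis
    using assms by (auto simp: mI_ball_def abs_minus_commute)
qed

text \<open>The triangle inequality handles the radii, and closure of \<open>I\<close> under
  addition handles \<open>f - h = (f - g) + (g - h)\<close>. The radii are arbitrary real functions,
  so sums of radii can be plugged in directly.\<close>

lemma mI_ball_trans:
  assumes I: "ideal I (Cont_ring X)" and "g \<in> mI_ball X I f u" "h \<in> mI_ball X I g v"
    and le: "\<And>x. x \<in> topspace X \<Longrightarrow> u x + v x \<le> w x"
  shows "h \<in> mI_ball X I f w"
proof -
  interpret ideal I "Cont_ring X" by (rule I)
  let ?T = "topspace X"
  let ?a = "\<lambda>x\<in>?T. f x - g x" and ?b = "\<lambda>x\<in>?T. g x - h x"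
  have "?a \<oplus>\<^bsub>Cont_ring X\<^esub> ?b \<in> I"
    using assms by (intro additive_subgroup.a_closed[OF additive_subgroup_axioms]) (auto simp: mI_ball_def)
  moreover have "?a \<oplus>\<^bsub>Cont_ring X\<^esub> ?b = (\<lambda>x\<in>?T. f x - h x)"
    by (auto simp: Cont_ring_def)
  moreover have "\<bar>f x - h x\<bar> < w x" if x: "x \<in> ?T" for x
  proof -
    have "\<bar>f x - g x\<bar> < u x" "\<bar>g x - h x\<bar> < v x"
      using assms(2,3) x by (auto simp: mI_ball_def)
    then show ?thesis using le[OF x] by linarith
  qed
  ultimately show ?thesis
    using assms(3) by (auto simp: mI_ball_def)
qed

lemma openin_mI_ball:
  assumes "ideal I (Cont_ring X)" "f \<in> Cont X" "u \<in> Cont_pos X"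
  shows "openin (mI_topology X I) (mI_ball X I f u)"
  unfolding openin_mI_topology[OF assms(1)]
  by (rule arbitrary_union_of_inc) (use assms in \<open>auto simp: mI_base_def\<close>)

lemma mI_ball_inside_open:
  assumes I: "ideal I (Cont_ring X)" and W: "openin (mI_topology X I) W" "g \<in> W"
  shows "\<exists>v\<in>Cont_pos X. mI_ball X I g v \<subseteq> W"
proof -
  have "base_of (mI_topology X I) (mI_base X I)"
    unfolding base_of_def openin_mI_topology[OF I] ..
  then obtain U where "U \<in> mI_base X I" "g \<in> U" "U \<subseteq> W"
    using base_ofD(2) W by metis
  then obtain f u where f: "f \<in> Cont X" and u: "u \<in> Cont_pos X"
    and g: "g \<in> mI_ball X I f u" and sub: "mI_ball X I f u \<subseteq> W"
    unfolding mI_base_def by blast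
  let ?T = "topspace X"
  \<comment> \<open>This is the slack \<open>u - \<bar>f - g\<bar>\<close> left at \<open>g\<close>,
    positive because \<open>g\<close> lies in the ball. The nested restrictions match the form of
    \<open>Cont_arith\<close>.\<close>
  define v where "v = (\<lambda>x\<in>?T. u x - (\<lambda>x\<in>?T. \<bar>(\<lambda>x\<in>?T. f x - g x) x\<bar>) x)"
  have "v \<in> Cont X"
    unfolding v_def using f g u by (intro Cont_arith) (auto simp: mI_ball_def Cont_pos_def)
  then have "v \<in> Cont_pos X"
    using g by (auto simp: Cont_pos_def v_def mI_ball_def)
  moreover have "mI_ball X I g v \<subseteq> mI_ball X I f u"
  proof
    fix h assume h: "h \<in> mI_ball X I g v"
    have "\<bar>f x - h x\<bar> < u x" if "x \<in> ?T" for x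
    proof -
      have "\<bar>g x - h x\<bar> < u x - \<bar>f x - g x\<bar>"
        using h that by (auto simp: mI_ball_def v_def)
      then show ?thesis by linarith
    qed
    \<comment> \<open>Only \<open>h \<in> Cont X\<close> and \<open>f - h \<in> I\<close> are taken
      from this fact; its radius is too large, and the sharp estimate is the one just
      proved.\<close>
    moreover have "h \<in> mI_ball X I f (\<lambda>x. u x + v x)"
      by (rule mI_ball_trans[OF I g h]) simp
    ultimately show "h \<in> mI_ball X I f u"
      by (auto simp: mI_ball_def)
  qed
  ultimately show ?thesis using sub by blast
qed

lemma Cont_pos_half:
  assumes "u \<in> Cont_pos X"
  shows "(\<lambda>x\<in>topspace X. u x / 2) \<in> Cont_pos X"
proof -
  have "(\<lambda>x\<in>topspace X. u x * (\<lambda>x\<in>topspace X. 1 / 2) x) \<in> Cont X"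
    using assms by (intro Cont_arith Cont_const) (auto simp: Cont_pos_def)
  then show ?thesis
    using assms by (simp add: Cont_pos_def cong: restrict_cong)
qed

lemma Cont_pos_inverse:
  assumes "u \<in> Cont_pos X"
  shows "(\<lambda>x\<in>topspace X. inverse (u x)) \<in> Cont_pos X"
proof -
  have "continuous_map X euclideanreal (\<lambda>x. inverse (u x))"
    using assms by (intro continuous_map_real_inverse) (fastforce simp: Cont_pos_def Cont_def)+
  then show ?thesis
    using assms by (auto simp: Cont_pos_def Cont_def)
qed

section \<open>Nets, coinitial radii and the resulting base\<close>

definition mI_net :: "'a topology \<Rightarrow> ('a \<Rightarrow> real) set \<Rightarrow> ('a \<Rightarrow> real) \<Rightarrow> ('a \<Rightarrow> real) set \<Rightarrow> bool" where
  "mI_net X I u D \<longleftrightarrow> D \<subseteq> Cont X \<and> Cont X \<subseteq> (\<Union>f\<in>D. mI_ball X I f u)"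

text \<open>Inversion reverses order: since every \<open>1/u\<close> lies within \<open>1\<close> of
  some net point \<open>f\<close>, the functions \<open>f + 1\<close> dominate all
  \<open>1/u\<close>, and their reciprocals get below every \<open>u\<close>.\<close>

lemma coinitial_from_unit_net:
  assumes D: "mI_net X I (\<lambda>x\<in>topspace X. 1) D"
  shows "\<exists>P\<subseteq>Cont_pos X. |P| \<le>o |D| \<and> (\<forall>u\<in>Cont_pos X. \<exists>p\<in>P. \<forall>x\<in>topspace X. p x \<le> u x)"
proof -
  let ?T = "topspace X"
  define s where "s f = (\<lambda>x\<in>?T. f x + (\<lambda>x\<in>?T. 1 :: real) x)" for f
  define r where "r f = (\<lambda>x\<in>?T. inverse (s f x))" for f
  \<comment> \<open>Only net points with \<open>f + 1\<close> positive everywhere have a reciprocal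
    in \<open>Cont_pos X\<close>; the others are discarded.\<close>
  define E where "E = {f \<in> D. \<forall>x\<in>?T. 0 < s f x}"
  have s: "s f \<in> Cont X" if "f \<in> D" for f
    unfolding s_def by (intro Cont_arith Cont_const) (use D that in \<open>auto simp: mI_net_def\<close>)
  have P: "r ` E \<subseteq> Cont_pos X"
    unfolding r_def E_def using s by (auto intro!: Cont_pos_inverse) (simp add: Cont_pos_def)
  have card: "|r ` E| \<le>o |D|"
    by (rule ordLeq_transitive[OF card_of_image card_of_mono1]) (auto simp: E_def)
  have "\<exists>p\<in>r ` E. \<forall>x\<in>?T. p x \<le> u x" if u: "u \<in> Cont_pos X" for u
  proof -
    let ?g = "\<lambda>x\<in>?T. inverse (u x)"
    have "?g \<in> Cont X"
      using Cont_pos_inverse[OF u] by (simp add: Cont_pos_def)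
    then obtain f where f: "f \<in> D" "?g \<in> mI_ball X I f (\<lambda>x\<in>?T. 1)"
      using D unfolding mI_net_def by blast
    have less: "inverse (u x) < s f x" and pos: "0 < u x" if "x \<in> ?T" for x
    proof -
      have "\<bar>f x - inverse (u x)\<bar> < 1"
        using f(2) that by (auto simp: mI_ball_def)
      then show "inverse (u x) < s f x" using that by (simp add: s_def)
      show "0 < u x" using u that by (simp add: Cont_pos_def)
    qed
    \<comment> \<open>The net point found for \<open>1/u\<close> survives the restriction to
      \<open>E\<close>, because \<open>f + 1 > 1/u > 0\<close>.\<close>
    have "0 < s f x" if "x \<in> ?T" for x
      using less[OF that] pos[OF that] by (meson less_trans positive_imp_inverse_positive)
    then have "f \<in> E" using f(1) by (simp add: E_def)
    moreover have "r f x \<le> u x" if "x \<in> ?T" for x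
    proof -
      have "inverse (s f x) \<le> inverse (inverse (u x))"
        using less[OF that] pos[OF that] by (intro le_imp_inverse_le) auto
      then show ?thesis using that by (simp add: r_def)
    qed
    ultimately show ?thesis by blast
  qed
  then show ?thesis using P card by blast
qed

text \<open>At most \<open>\<kappa>\<close> radii are coinitial, and each needs a net of at most
  \<open>\<kappa>\<close> centres; as \<open>\<kappa>\<close> is infinite, there are at most
  \<open>\<kappa>\<close> balls in all.\<close>

lemma base_from_nets:
  assumes I: "ideal I (Cont_ring X)" and \<kappa>: "Cinfinite \<kappa>"
    and nets: "\<And>u. u \<in> Cont_pos X \<Longrightarrow> \<exists>D. mI_net X I u D \<and> |D| \<le>o \<kappa>"
  shows "\<exists>\<B>. base_of (mI_topology X I) \<B> \<and> |\<B>| \<le>o \<kappa>"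
proof -
  let ?T = "topspace X"
  define half where "half p = (\<lambda>x\<in>?T. p x / 2 :: real)" for p
  have half: "half p \<in> Cont_pos X" if "p \<in> Cont_pos X" for p
    unfolding half_def by (rule Cont_pos_half[OF that])
  obtain N where N: "\<And>u. u \<in> Cont_pos X \<Longrightarrow> mI_net X I u (N u) \<and> |N u| \<le>o \<kappa>"
    using nets by metis
  have "(\<lambda>x\<in>?T. 1) \<in> Cont_pos X"
    by (auto simp: Cont_pos_def Cont_const)
  with N coinitial_from_unit_net obtain P where P: "P \<subseteq> Cont_pos X" "|P| \<le>o \<kappa>"
    and coinit: "\<And>u. u \<in> Cont_pos X \<Longrightarrow> \<exists>p\<in>P. \<forall>x\<in>?T. p x \<le> u x"
    by (metis ordLeq_transitive)
  \<comment> \<open>Radii are halved so that a ball around a nearby net point, rather than around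
    \<open>g\<close> itself, still fits inside the ball of radius \<open>p\<close> around
    \<open>g\<close>.\<close>
  define \<B> where "\<B> = (\<Union>p\<in>P. (\<lambda>f. mI_ball X I f (half p)) ` N (half p))"
  have "openin (mI_topology X I) B" if "B \<in> \<B>" for B
    using that N P(1) half unfolding \<B>_def mI_net_def
    by (blast intro: openin_mI_ball[OF I])
  moreover have "\<exists>B\<in>\<B>. g \<in> B \<and> B \<subseteq> W" if W: "openin (mI_topology X I) W" "g \<in> W" for g W
  proof -
    obtain u where u: "u \<in> Cont_pos X" "mI_ball X I g u \<subseteq> W"
      using mI_ball_inside_open[OF I W] by blast
    obtain p where p: "p \<in> P" "\<forall>x\<in>?T. p x \<le> u x"
      using coinit[OF u(1)] by blast
    have "g \<in> Cont X"
      using W openin_subset topspace_mI_topology[OF I] by blast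
    moreover have net: "mI_net X I (half p) (N (half p))"
      using N half p(1) P(1) by blast
    ultimately obtain f where f: "f \<in> N (half p)" "g \<in> mI_ball X I f (half p)"
      unfolding mI_net_def by blast
    have "f \<in> Cont X" using f(1) net unfolding mI_net_def by blast
    then have sym: "f \<in> mI_ball X I g (half p)"
      using f(2) by (rule mI_ball_sym[OF I])
    \<comment> \<open>Passing from \<open>g\<close> to \<open>f\<close> and from \<open>f\<close> to
      \<open>h\<close> costs \<open>p/2\<close> each, and \<open>p \<le> u\<close>.\<close>
    have "mI_ball X I f (half p) \<subseteq> mI_ball X I g u"
    proof
      fix h assume "h \<in> mI_ball X I f (half p)"
      then show "h \<in> mI_ball X I g u"
        using p(2) by (intro mI_ball_trans[OF I sym]) (auto simp: half_def)
    qed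
    then show ?thesis
      using f p(1) u(2) unfolding \<B>_def by blast
  qed
  ultimately have "base_of (mI_topology X I) \<B>"
    unfolding base_of_def openin_topology_base_unique by blast
  moreover have "|\<B>| \<le>o \<kappa>"
    unfolding \<B>_def
  proof (rule card_of_UNION_ordLeq_infinite_Field)
    show "infinite (Field \<kappa>)" "Card_order \<kappa>"
      using \<kappa> by (auto simp: cinfinite_def)
    show "\<forall>p\<in>P. |(\<lambda>f. mI_ball X I f (half p)) ` N (half p)| \<le>o \<kappa>"
      using N half P(1) by (blast intro: ordLeq_transitive[OF card_of_image])
  qed (rule P(2))
  ultimately show ?thesis by blast
qed

text \<open>This reduces each remaining inequality to finding, for every radius, a net no larger
  than the invariant in question. The net may depend on the radius.\<close>

lemma weight_le_nets:
  assumes "ideal I (Cont_ring X)" "Cinfinite \<kappa>"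
    and "\<And>u. u \<in> Cont_pos X \<Longrightarrow> \<exists>D. mI_net X I u D \<and> |D| \<le>o \<kappa>"
  shows "weight (mI_topology X I) \<le>o \<kappa>"
proof -
  obtain \<B> where "base_of (mI_topology X I) \<B>" "|\<B>| \<le>o \<kappa>"
    using base_from_nets[OF assms] by blast
  then show ?thesis
    using assms(2) by (rule weight_le)
qed

section \<open>Nets from dense sets, cellular families and open covers\<close>

lemma dense_is_net:
  assumes I: "ideal I (Cont_ring X)" and D: "dense_in (mI_topology X I) D" and u: "u \<in> Cont_pos X"
  shows "mI_net X I u D"
proof -
  have sub: "D \<subseteq> Cont X"
    using D topspace_mI_topology[OF I] unfolding dense_in_def by blast
  have "\<exists>f\<in>D. g \<in> mI_ball X I f u" if g: "g \<in> Cont X" for g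
  proof -
    \<comment> \<open>Density puts a point of \<open>D\<close> into the ball around
      \<open>g\<close>; a net needs \<open>g\<close> in the ball around that point, hence the appeal
      to symmetry.\<close>
    obtain f where "f \<in> D" "f \<in> mI_ball X I g u"
      using dense_inD[OF D openin_mI_ball[OF I g u]] mI_ball_centre[OF I g u] by blast
    then show ?thesis using mI_ball_sym[OF I g] by blast
  qed
  then show ?thesis using sub unfolding mI_net_def by blast
qed

lemma weight_le_density_number:
  assumes "ideal I (Cont_ring X)"
  shows "weight (mI_topology X I) \<le>o density_number (mI_topology X I)"
proof (rule weight_le_nets[OF assms])
  let ?Y = "mI_topology X I"
  show "Cinfinite (density_number ?Y)"
    unfolding density_number_def by (rule Cinfinite_natLeq_csum)
  obtain D where D: "dense_in ?Y D" "min_card {|D| | D. dense_in ?Y D} = |D|"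
    using min_card_card_of(1)[OF density_minimum_exists] by blast
  have "|D| \<le>o density_number ?Y"
    unfolding density_number_def D(2) by (rule ordLeq_csum2) (rule card_of_Card_order)
  then show "\<exists>D. mI_net X I u D \<and> |D| \<le>o density_number ?Y" if "u \<in> Cont_pos X" for u
    using dense_is_net[OF assms D(1) that] by blast
qed

text \<open>By Zorn's lemma there is a maximal set of centres whose balls of radius
  \<open>u/2\<close> are pairwise disjoint. The balls form the cellular family, and maximality makes
  the centres a net of radius \<open>u\<close>.\<close>

lemma cellular_net:
  assumes I: "ideal I (Cont_ring X)" and u: "u \<in> Cont_pos X"
  shows "\<exists>D \<U>. mI_net X I u D \<and> cellular_family (mI_topology X I) \<U> \<and> |D| \<le>o |\<U>|"
proof -
  define b where "b f = mI_ball X I f (\<lambda>x\<in>topspace X. u x / 2)" for f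
  note half = Cont_pos_half[OF u]
  define \<D> where "\<D> = {D. D \<subseteq> Cont X \<and> pairwise (\<lambda>f g. disjnt (b f) (b g)) D}"
  have "\<exists>M\<in>\<D>. \<forall>D\<in>\<D>. M \<subseteq> D \<longrightarrow> D = M"
  proof (rule subset_Zorn')
    fix C assume C: "subset.chain \<D> C"
    have "disjnt (b f) (b g)" if fg: "f \<in> \<Union>C" "g \<in> \<Union>C" "f \<noteq> g" for f g
    proof -
      obtain A B where AB: "A \<in> C" "f \<in> A" "B \<in> C" "g \<in> B"
        using fg by blast
      \<comment> \<open>Comparability in the chain places both centres in a single member, where
        disjointness is known.\<close>
      moreover have "A \<subseteq> B \<or> B \<subseteq> A"
        using C AB unfolding subset_chain_def by blast
      ultimately obtain A where "A \<in> C" "f \<in> A" "g \<in> A"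
        by blast
      then show ?thesis
        using C fg(3) unfolding subset_chain_def \<D>_def pairwise_def by blast
    qed
    moreover have "\<Union>C \<subseteq> Cont X"
      using C unfolding subset_chain_def \<D>_def by blast
    ultimately show "\<Union>C \<in> \<D>"
      unfolding \<D>_def pairwise_def by blast
  qed
  then obtain D where "D \<in> \<D>" and maximal: "\<And>E. E \<in> \<D> \<Longrightarrow> D \<subseteq> E \<Longrightarrow> E = D"
    by metis
  then have D: "D \<subseteq> Cont X" "pairwise (\<lambda>f g. disjnt (b f) (b g)) D"
    unfolding \<D>_def by simp_all
  have centre: "f \<in> b f" if "f \<in> Cont X" for f
    unfolding b_def using mI_ball_centre[OF I that half] .
  have "\<exists>f\<in>D. g \<in> mI_ball X I f u" if g: "g \<in> Cont X" for g
  proof -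
    \<comment> \<open>Otherwise \<open>g\<close> could be added to \<open>D\<close>, so maximality
      gives \<open>g \<in> D\<close>; but then \<open>b g\<close> would be disjoint from itself
      although it contains \<open>g\<close>.\<close>
    have "\<exists>f\<in>D. \<not> disjnt (b f) (b g)"
    proof (rule ccontr)
      assume none: "\<not> ?thesis"
      then have "insert g D \<in> \<D>"
        using D g unfolding \<D>_def by (auto simp: pairwise_insert dest: disjnt_sym)
      then have "g \<in> D" using maximal by blast
      then show False
        using none centre[OF g] unfolding disjnt_def by blast
    qed
    then obtain f h where f: "f \<in> D" and h: "h \<in> b f" "h \<in> b g"
      unfolding disjnt_def by blast
    \<comment> \<open>The common point \<open>h\<close> is within \<open>u/2\<close> of both
      \<open>f\<close> and \<open>g\<close>, so \<open>g\<close> is within \<open>u\<close> of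
      \<open>f\<close>.\<close>
    have "g \<in> b h"
      using h(2) unfolding b_def by (rule mI_ball_sym[OF I g])
    then have "g \<in> mI_ball X I f u"
      unfolding b_def by (rule mI_ball_trans[OF I h(1)[unfolded b_def]]) simp
    then show ?thesis using f by blast
  qed
  then have "mI_net X I u D"
    using D(1) unfolding mI_net_def by blast
  moreover have "cellular_family (mI_topology X I) (b ` D)"
    unfolding cellular_family_def
  proof
    show "\<forall>U\<in>b ` D. openin (mI_topology X I) U \<and> U \<noteq> {}"
      using D(1) centre openin_mI_ball[OF I _ half] unfolding b_def by blast
    show "pairwise disjnt (b ` D)"
      using D(2) by (auto simp: pairwise_image pairwise_def)
  qed
  \<comment> \<open>A cellular family counts balls, not centres. Distinct centres have disjoint
    nonempty balls, so no two centres share a ball.\<close>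
  moreover have "|D| \<le>o |b ` D|"
  proof -
    have "inj_on b D"
    proof (rule inj_onI, rule ccontr)
      fix f g assume fg: "f \<in> D" "g \<in> D" "b f = b g" "f \<noteq> g"
      have "disjnt (b f) (b g)"
        by (rule pairwiseD[OF D(2) fg(1,2,4)])
      moreover have "f \<in> b f"
        using centre fg(1) D(1) by blast
      ultimately show False
        using fg(3) unfolding disjnt_def by blast
    qed
    then show ?thesis
      using card_of_ordLeq by blast
  qed
  ultimately show ?thesis by blast
qed

lemma weight_le_cellularity:
  assumes "ideal I (Cont_ring X)"
  shows "weight (mI_topology X I) \<le>o cellularity (mI_topology X I)"
proof (rule weight_le_nets[OF assms])
  let ?Y = "mI_topology X I"
  show "Cinfinite (cellularity ?Y)"
    unfolding cellularity_def by (rule Cinfinite_natLeq_csum)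
  fix u assume "u \<in> Cont_pos X"
  then obtain D \<U> where D: "mI_net X I u D" "|D| \<le>o |\<U>|" and \<U>: "cellular_family ?Y \<U>"
    using cellular_net[OF assms] by blast
  have "|D| \<le>o sup_card {|\<U>| | \<U>. cellular_family ?Y \<U>}"
    using D(2) sup_card_cellular(2)[OF \<U>] by (rule ordLeq_transitive)
  \<comment> \<open>The cellular family varies with \<open>u\<close>; the supremum bounds all these
    families at once.\<close>
  also have "sup_card {|\<U>| | \<U>. cellular_family ?Y \<U>} \<le>o cellularity ?Y"
    unfolding cellularity_def by (rule ordLeq_csum2) (rule sup_card_cellular(1))
  finally show "\<exists>D. mI_net X I u D \<and> |D| \<le>o cellularity ?Y"
    using D(1) by blast
qed

text \<open>The balls of radius \<open>u\<close> around all points form an open cover; the centres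
  of a small subcover form a net.\<close>

lemma lindelof_net:
  assumes I: "ideal I (Cont_ring X)" and m: "lindelof_bound (mI_topology X I) m"
    and u: "u \<in> Cont_pos X"
  shows "\<exists>D. mI_net X I u D \<and> |D| \<le>o m"
proof -
  let ?b = "\<lambda>f. mI_ball X I f u"
  have "open_cover (mI_topology X I) (?b ` Cont X)"
    unfolding open_cover_def topspace_mI_topology[OF I]
    using openin_mI_ball[OF I _ u] mI_ball_centre[OF I _ u] by (auto simp: mI_ball_def)
  then obtain \<V> where \<V>: "\<V> \<subseteq> ?b ` Cont X" "open_cover (mI_topology X I) \<V>" "|\<V>| \<le>o m"
    using m unfolding lindelof_bound_def by blast
  \<comment> \<open>A ball may have several centres; \<open>inv_into\<close> fixes one for each
    member of \<open>\<V>\<close>, so the net is no larger than the subcover.\<close>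
  let ?D = "inv_into (Cont X) ?b ` \<V>"
  have "?D \<subseteq> Cont X"
    using \<V>(1) by (auto intro: inv_into_into)
  moreover have "(\<Union>f\<in>?D. ?b f) = \<Union>\<V>"
    using image_inv_into_cancel[OF refl \<V>(1)] by simp
  ultimately have "mI_net X I u ?D"
    using \<V>(2) unfolding mI_net_def open_cover_def topspace_mI_topology[OF I] by simp
  then show ?thesis
    using ordLeq_transitive[OF card_of_image \<V>(3)] by blast
qed

lemma weight_le_lindelof_number:
  assumes "ideal I (Cont_ring X)"
  shows "weight (mI_topology X I) \<le>o lindelof_number (mI_topology X I)"
proof (rule weight_le_nets[OF assms])
  let ?Y = "mI_topology X I"
  let ?m = "min_card {m. Card_order m \<and> lindelof_bound ?Y m}"
  show "Cinfinite (lindelof_number ?Y)"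
    unfolding lindelof_number_def by (rule Cinfinite_natLeq_csum)
  have "?m \<le>o lindelof_number ?Y"
    unfolding lindelof_number_def by (rule ordLeq_csum2) (rule min_card_lindelof(1))
  then show "\<exists>D. mI_net X I u D \<and> |D| \<le>o lindelof_number ?Y" if "u \<in> Cont_pos X" for u
    using lindelof_net[OF assms min_card_lindelof(2) that] ordLeq_transitive by blast
qed

theorem theorem5p11:
  fixes X :: "'a topology" and I :: "('a \<Rightarrow> real) set"
  assumes "tychonoff_space X"
    and "ideal I (Cont_ring X)"
  shows "weight (mI_topology X I) =o density_number (mI_topology X I) \<and>
         density_number (mI_topology X I) =o cellularity (mI_topology X I) \<and>
         cellularity (mI_topology X I) =o lindelof_number (mI_topology X I)"
proof -
  let ?Y = "mI_topology X I"
  \<comment> \<open>Each invariant is matched with the weight by two inequalities, and the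
    equalities between the other three are composed through the weight.\<close>
  have d: "weight ?Y =o density_number ?Y"
    using weight_le_density_number[OF assms(2)] density_number_le_weight
    by (simp add: ordIso_iff_ordLeq)
  have c: "weight ?Y =o cellularity ?Y"
    using weight_le_cellularity[OF assms(2)] cellularity_le_weight
    by (simp add: ordIso_iff_ordLeq)
  have l: "weight ?Y =o lindelof_number ?Y"
    using weight_le_lindelof_number[OF assms(2)] lindelof_number_le_weight
    by (simp add: ordIso_iff_ordLeq)
  show ?thesis
    using d ordIso_transitive[OF ordIso_symmetric[OF d] c]
      ordIso_transitive[OF ordIso_symmetric[OF c] l] by blast
qed

end
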